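(* Let $n\ge 1$. There exists a bijection $f$ from the set of binary trees with $n+1$ leaves to the set of torsion classes in $A_{n-1}$ such that $f(T)=\mathcal D_T$ for every such tree $T$. Furthermore, this bijection is order reversing: if $T_1\le T_2$ in the (Tamari) order on binary trees, then $f(T_1)\supseteq f(T_2)$.
   Context: A binary tree is a finite planar rooted tree in which every internal node has exactly two children. Let $T$ have $n+1$ leaves, numbered $0,1,\dots,n$ from left to right and drawn on the bottom level; the node whose subtree has leaves $i,i+1,\dots,j$ is drawn at the grid vertex $v_{i,j}=\left(\tfrac{i+j}{2},\tfrac{j-i}{2}\right)$. Edges of the tree are straight diagonal lines: descending (going down to the right; to right children, $j$ constant) or ascending (going up to the right; to left children, $i$ constant). Order on trees. The order on binary trees is the Tamari order, generated by the moves that shift a descending edge to the right, i.e. replace a subtree of the form $(AB)C$ by $A(BC)$ (where $A,B,C$ are subtrees); the tree after the move is larger. Ball structure. The balls are indexed by pairs $[i,j]$ with $1\le i\le j\le n-1$ (no balls if $n=1$); the ball $[i,j]$ fills the unit diamond with lowest corner $v_{i,j}$, left corner $v_{i-1,j}$, right corner $v_{i,j+1}$ and top corner $v_{i-1,j+1}$. The balls represent the indecomposable objects of the category of representations of the linearly oriented quiver of type $A_{n-1}$. Hom. $\mathrm{Hom}(X,Y)\ne0$ if and only if the entire rectangle with left corner $X$ and right corner $Y$ lies in the ball structure; explicitly, $\mathrm{Hom}([i,j],[i',j'])\neq0$ if and only if $i\le i'\le j\le j'$. Torsion classes. A pair $(\mathcal G,\mathcal F)$ of subsets of balls is a torsion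 pair if $\mathcal G=\{X:\mathrm{Hom}(X,Y)=0\ \text{for all } Y\in\mathcal F\}$ and $\mathcal F=\{Y:\mathrm{Hom}(X,Y)=0\ \text{for all } X\in\mathcal G\}$. A torsion class in $A_{n-1}$ is the set $\mathcal G$ of some torsion pair $(\mathcal G,\mathcal F)$. $\mathcal D_T$ is the set of balls sitting (directly) on descending edges of $T$: $[i,j]\in\mathcal D_T$ iff the lower-left side of its diamond, from $v_{i-1,j}$ to $v_{i,j}$, lies on a descending edge of $T$; equivalently, iff $a_j<i$, where $\{a_j,\dots,j\}$ is the leaf set of the largest subtree of $T$ whose rightmost leaf is $j$. *)

theory Defs
  imports "HOL-Analysis.Analysis" "HOL-Library.Tree"
begin

text \<open>Planar rooted binary trees without node labels. A \<open>Leaf\<close> is a leaf of the drawing, so the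
  number of leaves is \<^const>\<open>size1\<close>, while \<^const>\<open>size\<close> counts the internal nodes.\<close>

type_synonym btree = "unit tree"

abbreviation branch :: "btree \<Rightarrow> btree \<Rightarrow> btree" where
  "branch l r \<equiv> Node l () r"

definition binary_trees :: "nat \<Rightarrow> btree set" where
  "binary_trees m = {T. size1 T = m}"

inductive tamari_move :: "btree \<Rightarrow> btree \<Rightarrow> bool" where
  rotate: "tamari_move (branch (branch A B) C) (branch A (branch B C))"
| in_left: "tamari_move l l' \<Longrightarrow> tamari_move (branch l r) (branch l' r)"
| in_right: "tamari_move r r' \<Longrightarrow> tamari_move (branch l r) (branch l r')"

definition tamari_le :: "btree \<Rightarrow> btree \<Rightarrow> bool" where
  "tamari_le = tamari_move\<^sup>*\<^sup>*"

definition grid_vertex :: "nat \<Rightarrow> nat \<Rightarrow> real \<times> real" where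
  "grid_vertex i j = ((real i + real j) / 2, (real j - real i) / 2)"

text \<open>A subtree \<open>t\<close> whose leftmost leaf has number \<open>k\<close> has leaves \<open>k, \<dots>, k + size t\<close>.\<close>

definition root_position :: "nat \<Rightarrow> btree \<Rightarrow> real \<times> real" where
  "root_position k t = grid_vertex k (k + size t)"

text \<open>The edges to right children, as pairs (parent, child) of points in the plane, for the drawing
  in which the leftmost leaf has number \<open>k\<close>.\<close>

fun descending_edges :: "nat \<Rightarrow> btree \<Rightarrow> ((real \<times> real) \<times> (real \<times> real)) set" where
  "descending_edges k Leaf = {}"
| "descending_edges k (Node l u r) =
     insert (root_position k (Node l u r), root_position (k + size1 l) r)
       (descending_edges k l \<union> descending_edges (k + size1 l) r)"

text \<open>The ball \<open>[i,j]\<close> is represented by its index pair.\<close>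

type_synonym ball = "nat \<times> nat"

definition balls :: "nat \<Rightarrow> ball set" where
  "balls n = {(i, j). 1 \<le> i \<and> i \<le> j \<and> j \<le> n - 1}"

definition hom_nonzero :: "ball \<Rightarrow> ball \<Rightarrow> bool" where
  "hom_nonzero X Y \<longleftrightarrow> fst X \<le> fst Y \<and> fst Y \<le> snd X \<and> snd X \<le> snd Y"

definition torsion_pair :: "nat \<Rightarrow> ball set \<Rightarrow> ball set \<Rightarrow> bool" where
  "torsion_pair n G F \<longleftrightarrow>
     G = {X \<in> balls n. \<forall>Y\<in>F. \<not> hom_nonzero X Y} \<and>
     F = {Y \<in> balls n. \<forall>X\<in>G. \<not> hom_nonzero X Y}"

text \<open>The torsion classes in \<open>A\<^bsub>n-1\<^esub>\<close>.\<close>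

definition torsion_classes :: "nat \<Rightarrow> ball set set" where
  "torsion_classes n = {G. \<exists>F. torsion_pair n G F}"

text \<open>The set \<open>\<D>\<^sub>T\<close>. The side of the diamond lies on one descending edge. A tree with \<open>n + 1\<close> leaves
  has \<open>size T = n\<close>. The restriction to \<^const>\<open>balls\<close> matters: the descending edges ending in the last
  leaf \<open>n\<close> carry no balls.\<close>

definition balls_on_descending :: "btree \<Rightarrow> ball set" where
  "balls_on_descending T =
     {(i, j) \<in> balls (size T). \<exists>(p, q) \<in> descending_edges 0 T.
        closed_segment (grid_vertex (i - 1) j) (grid_vertex i j) \<subseteq> closed_segment p q}"

end

theory Submission
  imports Defs
begin

text \<open>Record a tree by the function \<open>a\<close> that sends a leaf \<open>j\<close> to the leftmost leaf of the largest
  subtree with rightmost leaf \<open>j\<close>. These functions are exactly the bracket vectors: \<open>a j \<le> j\<close>, and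
  \<open>a k \<le> j < k\<close> implies \<open>a k \<le> a j\<close>; the tree is recovered by splitting at the last \<open>j\<close> before the
  final leaf for which \<open>a j\<close> is minimal. On the other side, a set of balls closed under quotients is
  \<open>{[i,j]. a j < i}\<close> for a unique \<open>a\<close>, and being closed under extensions is the bracket vector
  condition on \<open>a\<close>. Rotating \<open>(AB)C\<close> to \<open>A(BC)\<close> can only increase \<open>a\<close>.\<close>

text \<open>Leaves keep their global numbers, with \<open>k\<close> the leftmost one. Values are
  meaningful for \<open>j\<close> from \<open>k\<close> to \<open>k + size t\<close>.\<close>

fun subtree_start :: "nat \<Rightarrow> btree \<Rightarrow> nat \<Rightarrow> nat" where
  "subtree_start k Leaf j = k"
| "subtree_start k (Node l u r) j =
     (if j = k + size (Node l u r) then k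
      else if j < k + size1 l then subtree_start k l j
      else subtree_start (k + size1 l) r j)"

text \<open>The second condition says that the intervals from \<open>a j\<close> to \<open>j\<close>
  are pairwise nested or disjoint. The final leaf \<open>k + n\<close> is left out: its value in a
  tree of size \<open>n\<close> is always \<open>k\<close>.\<close>

definition bracket_vector :: "nat \<Rightarrow> nat \<Rightarrow> (nat \<Rightarrow> nat) \<Rightarrow> bool" where
  "bracket_vector k n a \<longleftrightarrow>
     (\<forall>j. k \<le> j \<longrightarrow> j < k + n \<longrightarrow> k \<le> a j \<and> a j \<le> j) \<and>
     (\<forall>j j'. k \<le> j \<longrightarrow> j < j' \<longrightarrow> j' < k + n \<longrightarrow> a j' \<le> j \<longrightarrow> a j' \<le> a j)"

definition balls_above :: "nat \<Rightarrow> (nat \<Rightarrow> nat) \<Rightarrow> ball set" where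
  "balls_above n a = {(i, j) \<in> balls n. a j < i}"


section \<open>Trees and bracket vectors\<close>

lemma subtree_start_last [simp]: "subtree_start k t (k + size t) = k"
  by (cases t) auto

lemma subtree_start_ge: "k \<le> subtree_start k t j"
proof (induction t arbitrary: k)
  case (Node l u r)
  then show ?case
    using Node.IH(1)[of k] add_leD1[OF Node.IH(2)[of "k + size1 l"]] by simp
qed simp

lemma subtree_start_le: "k \<le> j \<Longrightarrow> j \<le> k + size t \<Longrightarrow> subtree_start k t j \<le> j"
  by (induction t arbitrary: k) (auto simp: size1_size)

text \<open>The last leaf has the minimal value \<open>k\<close>. For any other \<open>j'\<close> in
  the right subtree the value is at least the first leaf there, which forces \<open>j\<close> into
  the same subtree; for \<open>j'\<close> in the left subtree, \<open>j < j'\<close> does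
  so.\<close>

lemma subtree_start_bracket:
  "\<lbrakk>k \<le> j; j < j'; j' \<le> k + size t; subtree_start k t j' \<le> j\<rbrakk>
    \<Longrightarrow> subtree_start k t j' \<le> subtree_start k t j"
proof (induction t arbitrary: k)
  case (Node l u r)
  show ?case
  proof (cases "j' = k + size (Node l u r)")
    case True
    then show ?thesis by (simp only: subtree_start_last subtree_start_ge)
  next
    case False
    with Node.prems show ?thesis
      using Node.IH(1)[of k] Node.IH(2)[of "k + size1 l"]
        subtree_start_ge[of "k + size1 l" r j']
      by (auto simp: size1_size split: if_splits)
  qed
qed simp

lemma bracket_vector_subtree_start: "bracket_vector k (size t) (subtree_start k t)"
  by (simp add: bracket_vector_def subtree_start_ge subtree_start_le subtree_start_bracket)

text \<open>The last leaf of the left subtree has value \<open>k\<close>, while before the final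
  leaf all values in the right subtree exceed \<open>k\<close>. So the values determine where the
  root splits the leaves.\<close>

lemma subtree_start_inject:
  assumes "size t = size t'"
    and "\<And>j. k \<le> j \<Longrightarrow> j < k + size t \<Longrightarrow> subtree_start k t j = subtree_start k t' j"
  shows "t = t'"
  using assms
proof (induction t arbitrary: k t')
  case (Node l u r)
  obtain l' r' where t': "t' = branch l' r'"
    using Node.prems(1) by (cases t') auto
  have sz: "size l + size r = size l' + size r'"
    using Node.prems(1) t' by simp
  have eq: "subtree_start k (branch l r) j = subtree_start k (branch l' r') j"
    if "k \<le> j" "j < k + size (branch l r)" for j
    using Node.prems(2)[of j] that t' by simp
  have "\<not> size l < size l'"
  proof
    assume "size l < size l'"
    then have "subtree_start (k + size1 l) r (k + size l') = k"
      using eq[of "k + size l'"] sz by (simp add: size1_size)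
    then show False
      using subtree_start_ge[of "k + size1 l" r "k + size l'"] by (simp add: size1_size)
  qed
  moreover have "\<not> size l' < size l"
  proof
    assume "size l' < size l"
    then have "subtree_start (k + size1 l') r' (k + size l) = k"
      using eq[of "k + size l"] sz by (simp add: size1_size)
    then show False
      using subtree_start_ge[of "k + size1 l'" r' "k + size l"] by (simp add: size1_size)
  qed
  ultimately have szl: "size l = size l'" by simp
  have "l = l'"
  proof (rule Node.IH(1)[OF szl])
    show "subtree_start k l j = subtree_start k l' j" if "k \<le> j" "j < k + size l" for j
      using eq[of j] that szl sz by (simp add: size1_size)
  qed
  moreover have "r = r'"
  proof (rule Node.IH(2))
    show "size r = size r'" using szl sz by simp
    show "subtree_start (k + size1 l) r j = subtree_start (k + size1 l) r' j"
      if "k + size1 l \<le> j" "j < k + size1 l + size r" for j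
      using eq[of j] that szl sz by (simp add: size1_size)
  qed
  ultimately show ?case using t' by simp
qed simp

lemma bracket_vector_realized:
  assumes "bracket_vector k n a"
  shows "\<exists>t. size t = n \<and> (\<forall>j. k \<le> j \<longrightarrow> j < k + n \<longrightarrow> subtree_start k t j = a j)"
  using assms
proof (induction n arbitrary: k rule: less_induct)
  case (less n)
  note a = less.prems[unfolded bracket_vector_def]
  show ?case
  proof (cases "n = 0")
    case True
    then show ?thesis by (intro exI[of _ Leaf]) simp
  next
    case False
    define M where "M = {j. k \<le> j \<and> j < k + n \<and> a j = k}"
    define m where "m = Max M"
    have fin: "finite M" by (simp add: M_def)
    have "k \<in> M" using a False by (force simp: M_def)
    then have "m \<in> M" unfolding m_def using fin by (intro Max_in) auto
    then have m: "k \<le> m" "m < k + n" "a m = k" by (auto simp: M_def)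
    \<comment> \<open>If \<open>a j \<le> m < j\<close>, the bracket condition gives
      \<open>a j \<le> a m = k\<close>, against the maximality of \<open>m\<close>. Hence the values
      beyond \<open>m\<close> form a bracket vector starting at \<open>Suc m\<close>.\<close>
    have after: "m < a j" if "m < j" "j < k + n" for j
    proof (rule ccontr)
      assume "\<not> m < a j"
      then have "a j = k" using a m that by (metis le_antisym le_trans less_imp_le_nat not_less)
      then have "j \<in> M" using that m by (simp add: M_def)
      then show False using Max_ge[OF fin, of j] that by (simp add: m_def)
    qed
    have "m - k < n" using m by linarith
    moreover have "bracket_vector k (m - k) a"
      using a m by (simp add: bracket_vector_def)
    ultimately obtain l where l: "size l = m - k"
      "\<And>j. k \<le> j \<Longrightarrow> j < m \<Longrightarrow> subtree_start k l j = a j"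
      using less.IH[of "m - k" k] m(1,2) by auto
    have "k + n - Suc m < n" using m by linarith
    moreover have "bracket_vector (Suc m) (k + n - Suc m) a"
      using a m after by (auto simp: bracket_vector_def Suc_le_eq)
    ultimately obtain r where r: "size r = k + n - Suc m"
      "\<And>j. m < j \<Longrightarrow> j < k + n \<Longrightarrow> subtree_start (Suc m) r j = a j"
      using less.IH[of "k + n - Suc m" "Suc m"] m(1,2) by (auto simp: Suc_le_eq)
    \<comment> \<open>The leaf \<open>m\<close> is the last one of \<open>l\<close>, just outside
      the range supplied by induction.\<close>
    have "subtree_start k l m = k"
      using subtree_start_last[of k l] l(1) m by simp
    then have "subtree_start k (branch l r) j = a j" if "k \<le> j" "j < k + n" for j
      using that l r m by (cases j m rule: linorder_cases) (auto simp: size1_size)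
    moreover have "size (branch l r) = n" using l(1) r(1) m by simp
    ultimately show ?thesis by blast
  qed
qed

section \<open>Monotonicity along the Tamari order\<close>

lemma tamari_move_size: "tamari_move t t' \<Longrightarrow> size t' = size t"
  by (induction rule: tamari_move.induct) auto

text \<open>A rotation changes the value at a single leaf, the last leaf of \<open>B\<close>: it
  moves from the first leaf of \<open>A\<close> to the first leaf of \<open>B\<close>.\<close>

lemma tamari_move_subtree_start:
  "\<lbrakk>tamari_move t t'; k \<le> j; j \<le> k + size t\<rbrakk> \<Longrightarrow> subtree_start k t j \<le> subtree_start k t' j"
proof (induction arbitrary: k rule: tamari_move.induct)
  case (rotate A B C)
  have "subtree_start k A j \<le> j" if "j < k + size1 A"
    using that rotate by (intro subtree_start_le) (auto simp: size1_size)
  then show ?case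
    using rotate add_leD1[OF subtree_start_ge[of "k + size1 A" B j]]
    by (auto simp: size1_size add_ac not_less)
next
  case (in_left l l' r)
  then show ?case using tamari_move_size[of l l'] by (auto simp: size1_size)
next
  case (in_right r r' l)
  then show ?case using tamari_move_size[of r r'] by (auto simp: size1_size)
qed

lemma tamari_le_subtree_start:
  assumes "tamari_le t t'"
  shows "size t' = size t \<and>
    (\<forall>j. k \<le> j \<longrightarrow> j \<le> k + size t \<longrightarrow> subtree_start k t j \<le> subtree_start k t' j)"
  using assms unfolding tamari_le_def
proof (induction rule: rtranclp_induct)
  case (step y z)
  then show ?case
    using tamari_move_size[of y z] tamari_move_subtree_start[of y z k] by (metis le_trans)
qed simp


section \<open>Balls on descending edges\<close>

text \<open>The sum of the plane coordinates of \<open>grid_vertex x y\<close> is \<open>y\<close>,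
  and the first minus the second is \<open>x\<close>. Along the segment the sum is constantly
  \<open>c\<close>, and the difference runs from \<open>a\<close> to \<open>b\<close>.\<close>

lemma grid_vertex_in_segment:
  assumes "a \<le> b"
  shows "grid_vertex x y \<in> closed_segment (grid_vertex a c) (grid_vertex b c)
    \<longleftrightarrow> y = c \<and> a \<le> x \<and> x \<le> b"
proof
  assume "grid_vertex x y \<in> closed_segment (grid_vertex a c) (grid_vertex b c)"
  then obtain u where u: "0 \<le> u" "u \<le> 1"
    and "grid_vertex x y = (1 - u) *\<^sub>R grid_vertex a c + u *\<^sub>R grid_vertex b c"
    by (auto simp: in_segment)
  then have 1: "(real x + real y) / 2 = (1 - u) * ((real a + real c) / 2) + u * ((real b + real c) / 2)"
    and 2: "(real y - real x) / 2 = (1 - u) * ((real c - real a) / 2) + u * ((real c - real b) / 2)"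
    by (auto simp: grid_vertex_def)
  have "real y = (real x + real y) / 2 + (real y - real x) / 2" by (simp add: field_simps)
  also have "\<dots> = real c" unfolding 1 2 by (simp add: field_simps)
  finally have y: "y = c" by simp
  have "real x = (real x + real y) / 2 - (real y - real x) / 2" by (simp add: field_simps)
  also have "\<dots> = real a + u * (real b - real a)" unfolding 1 2 by (simp add: field_simps)
  finally have x: "real x = real a + u * (real b - real a)" .
  have "0 \<le> u * (real b - real a)" "u * (real b - real a) \<le> 1 * (real b - real a)"
    using u assms mult_right_mono[of u 1 "real b - real a"] by auto
  then have "real a \<le> real x" "real x \<le> real b" using x by auto
  with y show "y = c \<and> a \<le> x \<and> x \<le> b" by simp
next
  assume h: "y = c \<and> a \<le> x \<and> x \<le> b"
  show "grid_vertex x y \<in> closed_segment (grid_vertex a c) (grid_vertex b c)"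
  proof (cases "a = b")
    case True
    then have "x = b" using h by simp
    then show ?thesis using h by simp
  next
    case False
    define u where "u = (real x - real a) / (real b - real a)"
    have ab: "0 < real b - real a" using False assms by simp
    have x: "real x = real a + u * (real b - real a)" using ab by (simp add: u_def)
    have "0 \<le> u" "u \<le> 1" using ab h by (auto simp: u_def divide_simps)
    moreover have "grid_vertex x y = (1 - u) *\<^sub>R grid_vertex a c + u *\<^sub>R grid_vertex b c"
      using h x by (simp add: grid_vertex_def field_simps)
    ultimately show ?thesis by (auto simp: in_segment)
  qed
qed

text \<open>A node and its right child share their rightmost leaf \<open>c\<close>; \<open>a\<close>
  and \<open>b\<close> are their leftmost leaves.\<close>

lemma descending_edges_shape:
  assumes "(p, q) \<in> descending_edges k t"
  obtains a b c where "p = grid_vertex a c" "q = grid_vertex b c"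
    "k \<le> a" "a \<le> b" "b \<le> c" "c \<le> k + size t"
  using assms
proof (induction t arbitrary: k thesis)
  case (Node l u r)
  from Node.prems(2) consider
    (root) "p = root_position k (Node l u r)" "q = root_position (k + size1 l) r"
    | (left) "(p, q) \<in> descending_edges k l"
    | (right) "(p, q) \<in> descending_edges (k + size1 l) r" by auto
  then show ?case
  proof cases
    case root
    then show ?thesis
      using Node.prems(1)[of k "k + size (Node l u r)" "k + size1 l"]
      by (simp add: root_position_def size1_size add_ac)
  next
    case left
    show ?thesis
      by (rule Node.IH(1)[OF _ left]) (rule Node.prems(1), assumption, assumption, auto)
  next
    case right
    show ?thesis
      by (rule Node.IH(2)[OF _ right]) (rule Node.prems(1), assumption, assumption, auto simp: size1_size)
  qed
qed simp

definition covers :: "(real \<times> real) \<times> (real \<times> real) \<Rightarrow> nat \<Rightarrow> nat \<Rightarrow> bool" where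
  "covers e i j \<longleftrightarrow>
     closed_segment (grid_vertex (i - 1) j) (grid_vertex i j) \<subseteq> closed_segment (fst e) (snd e)"

text \<open>By convexity only the endpoints matter. Their first indices are \<open>i - 1\<close> and
  \<open>i\<close>, and \<open>1 \<le> i\<close> turns \<open>a \<le> i - 1\<close> into
  \<open>a < i\<close>.\<close>

lemma covers_grid_edge:
  assumes "a \<le> b" "1 \<le> i"
  shows "covers (grid_vertex a c, grid_vertex b c) i j \<longleftrightarrow> j = c \<and> a < i \<and> i \<le> b"
  using assms by (auto simp: covers_def subset_closed_segment grid_vertex_in_segment)

text \<open>Excludes edges of the wrong subtree when \<open>covered_iff\<close> is proved by
  induction.\<close>

lemma covers_descending_edge:
  assumes "e \<in> descending_edges k t" "covers e i j" "1 \<le> i"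
  shows "k < i \<and> j \<le> k + size t"
proof -
  obtain p q where e: "e = (p, q)" by (rule prod.exhaust)
  show ?thesis
    using descending_edges_shape[OF assms(1)[unfolded e]] assms(2,3)
    by (metis covers_grid_edge e le_less_trans)
qed

lemma covered_iff:
  assumes "1 \<le> i" "i \<le> j" "k \<le> j" "j \<le> k + size t"
  shows "(\<exists>e\<in>descending_edges k t. covers e i j) \<longleftrightarrow> subtree_start k t j < i"
  using assms
proof (induction t arbitrary: k)
  case (Node l u r)
  let ?m = "k + size1 l" and ?N = "k + size (Node l u r)"
  have root: "covers (root_position k (Node l u r), root_position ?m r) i j
      \<longleftrightarrow> j = ?N \<and> k < i \<and> i \<le> ?m"
    using covers_grid_edge[of k ?m i ?N j] Node.prems
    by (simp add: root_position_def size1_size add_ac)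
  have left: "(\<exists>e\<in>descending_edges k l. covers e i j) \<longleftrightarrow> j < ?m \<and> subtree_start k l j < i"
  proof (cases "j < ?m")
    case True
    then show ?thesis using Node.IH(1)[of k] Node.prems by (simp add: size1_size)
  next
    case False
    then show ?thesis
      using covers_descending_edge[of _ k l i j] Node.prems by (auto simp: size1_size)
  qed
  have right: "(\<exists>e\<in>descending_edges ?m r. covers e i j)
      \<longleftrightarrow> ?m \<le> j \<and> subtree_start ?m r j < i"
  proof (cases "?m \<le> j")
    case True
    then show ?thesis using Node.IH(2)[of ?m] Node.prems by (simp add: size1_size)
  next
    case False
    then show ?thesis
      using covers_descending_edge[of _ ?m r i j] Node.prems by auto
  qed
  have "(\<exists>e\<in>descending_edges k (Node l u r). covers e i j) \<longleftrightarrow>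
      j = ?N \<and> k < i \<and> i \<le> ?m \<or> j < ?m \<and> subtree_start k l j < i
      \<or> ?m \<le> j \<and> subtree_start ?m r j < i"
    using root left right by auto
  \<comment> \<open>For the last leaf \<open>?N\<close>, the root edge covers
    \<open>k < i \<le> ?m\<close> and the edges of \<open>r\<close> cover \<open>?m < i\<close>;
    together this is \<open>k < i\<close>.\<close>
  moreover have "subtree_start ?m r ?N = ?m"
    using subtree_start_last[of ?m r] by (simp add: size1_size add_ac)
  ultimately show ?case by (auto simp: size1_size)
next
  case Leaf
  then show ?case by simp
qed

lemma balls_on_descending_eq:
  "balls_on_descending t = balls_above (size t) (subtree_start 0 t)"
proof -
  have "(\<exists>(p, q)\<in>descending_edges 0 t.
        closed_segment (grid_vertex (i - 1) j) (grid_vertex i j) \<subseteq> closed_segment p q)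
      \<longleftrightarrow> subtree_start 0 t j < i" if "(i, j) \<in> balls (size t)" for i j
  proof -
    have "1 \<le> i" "i \<le> j" "j \<le> size t" using that by (auto simp: balls_def)
    then show ?thesis
      using covered_iff[of i j 0 t] by (simp add: covers_def case_prod_unfold)
  qed
  then show ?thesis by (auto simp: balls_on_descending_def balls_above_def)
qed


section \<open>Torsion classes and bracket vectors\<close>

lemma balls_above_inject:
  assumes "balls_above n a = balls_above n b" "1 \<le> j" "j < n" "a j \<le> j" "b j \<le> j"
  shows "a j = b j"
proof -
  have *: "a j < i \<longleftrightarrow> b j < i" if "1 \<le> i" "i \<le> j" for i
  proof -
    have "(i, j) \<in> balls n" using that assms(3) by (simp add: balls_def)
    then show ?thesis using assms(1) by (auto simp: balls_above_def set_eq_iff)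
  qed
  \<comment> \<open>If \<open>a j < b j\<close>, the ball \<open>(Suc (a j), j)\<close> would lie in
    the first set only; the other case is symmetric.\<close>
  show ?thesis
    using *[of "Suc (a j)"] *[of "Suc (b j)"] assms(4,5) by linarith
qed

text \<open>With \<open>F\<close> the set of balls receiving no nonzero map from \<open>?G\<close>,
  it remains to find, for each ball outside \<open>?G\<close>, a nonzero map to a member of
  \<open>F\<close>.\<close>

lemma balls_above_torsion_class:
  assumes "bracket_vector 0 n a"
  shows "balls_above n a \<in> torsion_classes n"
proof -
  let ?G = "balls_above n a"
  define F where "F = {Y \<in> balls n. \<forall>X\<in>?G. \<not> hom_nonzero X Y}"
  have "X \<in> ?G" if X: "X \<in> balls n" and F: "\<forall>Y\<in>F. \<not> hom_nonzero X Y" for X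
  proof (rule ccontr)
    obtain i j where ij: "X = (i, j)" by force
    assume "X \<notin> ?G"
    then have ia: "i \<le> a j" using X ij by (simp add: balls_above_def)
    have i: "1 \<le> i" "i \<le> j" "j < n" using X ij by (auto simp: balls_def)
    \<comment> \<open>\<open>[i,m]\<close> is the largest torsion subobject of \<open>[i,j]\<close> (zero if \<open>m = i - 1\<close>), so the quotient
      \<open>[m+1,j]\<close> is torsion-free and nonzero.\<close>
    define M where "M = {m. m < j \<and> (m = i - 1 \<or> i \<le> m \<and> a m < i)}"
    define m where "m = Max M"
    have fin: "finite M" by (simp add: M_def)
    have "i - 1 \<in> M" using i by (auto simp: M_def)
    then have "m \<in> M" "i - 1 \<le> m" unfolding m_def using fin by (auto intro: Max_in)
    then have m: "m < j" "i \<le> Suc m" "m = i - 1 \<or> a m < i" by (auto simp: M_def)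
    have "(Suc m, j) \<in> F"
    proof -
      have "\<not> hom_nonzero Z (Suc m, j)" if Z: "Z \<in> ?G" for Z
      proof
        assume h: "hom_nonzero Z (Suc m, j)"
        obtain p q where pq: "Z = (p, q)" by force
        have q: "a q < p" "p \<le> Suc m" "Suc m \<le> q" "q \<le> j"
          using Z h pq by (auto simp: balls_above_def hom_nonzero_def)
        \<comment> \<open>A nonzero map from \<open>[p,q]\<close> would make \<open>[i,q]\<close> a
          torsion subobject of \<open>[i,j]\<close> with \<open>q > m\<close>: the bracket condition
          yields \<open>a q < i\<close>, and \<open>q = j\<close> is impossible because
          \<open>i \<le> a j\<close>.\<close>
        have "a q \<le> m" "m < q" "q < n" using q i by auto
        then have "a q \<le> a m" using assms by (simp add: bracket_vector_def)
        then have aq: "a q < i" using m q i by auto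
        then have "q < j" using ia q by (cases "q = j") auto
        then have "q \<in> M" using aq q m by (auto simp: M_def)
        then have "q \<le> m" unfolding m_def by (rule Max_ge[OF fin])
        then show False using q by simp
      qed
      then show ?thesis using m i by (auto simp: F_def balls_def)
    qed
    moreover have "hom_nonzero X (Suc m, j)" using m ij by (simp add: hom_nonzero_def)
    ultimately show False using F by blast
  qed
  then have "?G = {X \<in> balls n. \<forall>Y\<in>F. \<not> hom_nonzero X Y}"
    unfolding F_def by (auto simp: balls_above_def)
  then show ?thesis
    unfolding torsion_classes_def torsion_pair_def F_def by blast
qed

section \<open>From a torsion class to its bracket vector\<close>

lemma torsion_class_subset_balls: "G \<in> torsion_classes n \<Longrightarrow> G \<subseteq> balls n"
  by (auto simp: torsion_classes_def torsion_pair_def)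

text \<open>\<open>[i',j]\<close> is a quotient of \<open>[i,j]\<close>, so a nonzero map out of it
  composes to a nonzero map out of \<open>[i,j]\<close>.\<close>

lemma torsion_class_quotient:
  assumes "G \<in> torsion_classes n" "(i, j) \<in> G" "i \<le> i'" "i' \<le> j"
  shows "(i', j) \<in> G"
proof -
  obtain F where G: "G = {X \<in> balls n. \<forall>Y\<in>F. \<not> hom_nonzero X Y}"
    using assms(1) unfolding torsion_classes_def torsion_pair_def by blast
  show ?thesis using assms(2-4) unfolding G by (fastforce simp: balls_def hom_nonzero_def)
qed

text \<open>\<open>[i,k]\<close> has subobject \<open>[i,j]\<close> and quotient
  \<open>[j+1,k]\<close>. A nonzero map to \<open>Y\<close> restricts to a nonzero map on the
  subobject if \<open>fst Y \<le> j\<close>, and otherwise factors through the quotient.\<close>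

lemma torsion_class_extension:
  assumes "G \<in> torsion_classes n" "(i, j) \<in> G" "(Suc j, k) \<in> G"
  shows "(i, k) \<in> G"
proof -
  obtain F where G: "G = {X \<in> balls n. \<forall>Y\<in>F. \<not> hom_nonzero X Y}"
    using assms(1) unfolding torsion_classes_def torsion_pair_def by blast
  have "\<not> hom_nonzero (i, k) Y" if "Y \<in> F" for Y
  proof -
    have "\<not> hom_nonzero (i, j) Y" "\<not> hom_nonzero (Suc j, k) Y" "Suc j \<le> k"
      using that assms(2,3) unfolding G by (auto simp: balls_def)
    then show ?thesis by (cases "fst Y \<le> j") (auto simp: hom_nonzero_def)
  qed
  moreover have "(i, k) \<in> balls n" using assms(2,3) unfolding G by (auto simp: balls_def)
  ultimately show ?thesis unfolding G by simp
qed

lemma torsion_class_bracket_vector: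
  assumes G: "G \<in> torsion_classes n"
  obtains a where "bracket_vector 0 n a" "G = balls_above n a"
proof -
  \<comment> \<open>The alternative \<open>i = j\<close> supplies the default \<open>a j = j\<close>
    when \<open>G\<close> has no ball with second index \<open>j\<close>.\<close>
  define P where "P j i \<longleftrightarrow> i = j \<or> (Suc i, j) \<in> G" for i j
  define a where "a j = (LEAST i. P j i)" for j
  have Pa: "P j (a j)" for j
    unfolding a_def by (rule LeastI[of _ j]) (simp add: P_def)
  have a_least: "a j \<le> i" if "P j i" for i j
    unfolding a_def by (rule Least_le) (rule that)
  have a_le: "a j \<le> j" for j by (rule a_least) (simp add: P_def)
  have "a k \<le> a j" if "j < k" "a k \<le> j" for j k
  proof (cases "a j = j")
    case False
    then have j: "(Suc (a j), j) \<in> G" using Pa[of j] by (simp add: P_def)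
    have "(Suc (a k), k) \<in> G" using Pa[of k] that by (auto simp: P_def)
    \<comment> \<open>This quotient of \<open>[a k + 1, k]\<close> starts right after
      \<open>[a j + 1, j]\<close>, so the two can be glued by an extension, and minimality of
      \<open>a k\<close> applies to the result.\<close>
    then have "(Suc j, k) \<in> G"
      by (rule torsion_class_quotient[OF G]) (use that in auto)
    with j have "(Suc (a j), k) \<in> G" by (rule torsion_class_extension[OF G])
    then show ?thesis by (intro a_least) (simp add: P_def)
  qed (use that in simp)
  then have "bracket_vector 0 n a" using a_le by (simp add: bracket_vector_def)
  moreover have "G = balls_above n a"
  proof (intro set_eqI iffI)
    fix X assume X: "X \<in> G"
    obtain i j where ij: "X = (i, j)" by force
    have b: "X \<in> balls n" using X torsion_class_subset_balls[OF G] by auto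
    then have "P j (i - 1)" using X ij by (auto simp: P_def balls_def)
    then have "a j < i" using a_least[of j "i - 1"] b ij by (auto simp: balls_def)
    then show "X \<in> balls_above n a" using b ij by (simp add: balls_above_def)
  next
    fix X assume "X \<in> balls_above n a"
    then obtain i j where ij: "X = (i, j)" "(i, j) \<in> balls n" "a j < i"
      by (auto simp: balls_above_def)
    then have "i \<le> j" by (simp add: balls_def)
    with ij have "(Suc (a j), j) \<in> G" using Pa[of j] by (auto simp: P_def)
    then show "X \<in> G"
      unfolding ij(1) by (rule torsion_class_quotient[OF G]) (use ij \<open>i \<le> j\<close> in auto)
  qed
  ultimately show ?thesis by (rule that)
qed

section \<open>The order-reversing bijection\<close>

lemma size_binary_tree: "T \<in> binary_trees (n + 1) \<Longrightarrow> size T = n"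
  by (simp add: binary_trees_def size1_size)

theorem theorem4p6:
  fixes n :: nat
  assumes "n \<ge> 1"
  shows "\<exists>f :: btree \<Rightarrow> ball set.
    bij_betw f (binary_trees (n + 1)) (torsion_classes n) \<and>
    (\<forall>T \<in> binary_trees (n + 1). f T = balls_on_descending T) \<and>
    (\<forall>T1 \<in> binary_trees (n + 1). \<forall>T2 \<in> binary_trees (n + 1).
       tamari_le T1 T2 \<longrightarrow> f T2 \<subseteq> f T1)"
proof (intro exI[of _ balls_on_descending] conjI ballI impI)
  show "bij_betw balls_on_descending (binary_trees (n + 1)) (torsion_classes n)"
    unfolding bij_betw_def
  proof (intro conjI inj_onI equalityI subsetI)
    fix S T assume S: "S \<in> binary_trees (n + 1)" and T: "T \<in> binary_trees (n + 1)"
      and eq: "balls_on_descending S = balls_on_descending T"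
    show "S = T"
    proof (rule subtree_start_inject[where k = 0])
      fix j assume "j < 0 + size S"
      then have j: "j < n" using size_binary_tree[OF S] by simp
      have le: "subtree_start 0 S j \<le> j" "subtree_start 0 T j \<le> j"
        using j size_binary_tree[OF S] size_binary_tree[OF T] by (auto intro!: subtree_start_le)
      show "subtree_start 0 S j = subtree_start 0 T j"
      \<comment> \<open>No ball has second index \<open>0\<close>, but there the value is
        \<open>0\<close> for both trees.\<close>
      proof (cases "j = 0")
        case True
        then show ?thesis using le by simp
      next
        case False
        then show ?thesis
          using eq le j size_binary_tree[OF S] size_binary_tree[OF T]
          by (intro balls_above_inject[of n]) (auto simp: balls_on_descending_eq)
      qed
    qed (simp add: size_binary_tree[OF S] size_binary_tree[OF T])
  next
    fix G assume "G \<in> balls_on_descending ` binary_trees (n + 1)"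
    then show "G \<in> torsion_classes n"
      using balls_above_torsion_class bracket_vector_subtree_start size_binary_tree
      by (metis balls_on_descending_eq imageE)
  next
    fix G assume "G \<in> torsion_classes n"
    then obtain a where a: "bracket_vector 0 n a" "G = balls_above n a"
      by (rule torsion_class_bracket_vector)
    obtain T where T: "size T = n" "\<And>j. j < n \<Longrightarrow> subtree_start 0 T j = a j"
      using bracket_vector_realized[OF a(1)] by auto
    \<comment> \<open>Balls have second index at most \<open>n - 1\<close>, so agreement below the
      final leaf \<open>n\<close> suffices.\<close>
    have "G = balls_on_descending T"
      unfolding a(2) balls_on_descending_eq T(1) balls_above_def
      using T(2) assms by (auto simp: balls_def)
    moreover have "T \<in> binary_trees (n + 1)"
      using T(1) by (simp add: binary_trees_def size1_size)
    ultimately show "G \<in> balls_on_descending ` binary_trees (n + 1)" by blast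
  qed
next
  fix T1 T2 assume T: "T1 \<in> binary_trees (n + 1)" "T2 \<in> binary_trees (n + 1)"
    and "tamari_le T1 T2"
  then have "subtree_start 0 T1 j \<le> subtree_start 0 T2 j" if "j \<le> n - 1" for j
    using tamari_le_subtree_start[of T1 T2 0] that size_binary_tree by simp
  \<comment> \<open>Raising the bounds removes balls, which is why the order is reversed.\<close>
  then have "balls_above n (subtree_start 0 T2) \<subseteq> balls_above n (subtree_start 0 T1)"
    by (fastforce simp: balls_above_def balls_def intro: le_less_trans)
  then show "balls_on_descending T2 \<subseteq> balls_on_descending T1"
    using T size_binary_tree by (simp add: balls_on_descending_eq)
qed simp

end
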